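(* Let $n\ge1$, and on $\mathbb R^{2n+1}$ with coordinates $(\mathbf u,\mathbf v,t)$, $\mathbf u=(u_1,\dots,u_n)$, $\mathbf v=(v_1,\dots,v_n)\in\mathbb R^n$, $t\in\mathbb R$ (the hyperbolic Heisenberg group of topological dimension $2n+1$), let $U_k=\partial_{u_k}-2v_k\partial_t$, $V_k=\partial_{v_k}+2u_k\partial_t$ and $\mathcal L=\sum_{k=1}^n(U_k^2-V_k^2)$. For every $\epsilon>0$ the function $$\varphi_\epsilon(\mathbf u,\mathbf v,t)=\left(\frac{4n^2\epsilon^2}{(\epsilon^2+|\mathbf u|^2-|\mathbf v|^2)^2-t^2}\right)^{n/2}$$ is a solution of the ultrahyperbolic Yamabe equation $$\mathcal L\varphi=-\varphi^{2^*-1},\qquad 2^*-1=\frac{n+2}{n},$$ on the set where $\bigl|\epsilon^2+|\mathbf u|^2-|\mathbf v|^2\bigr|\ne|t|$.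
   Context: $|\mathbf u|=(u_1^2+\dots+u_n^2)^{1/2}$, and similarly for $\mathbf v$. Here $2^*-1=(Q+2)/(Q-2)$ with $Q=2n+2$ the homogeneous dimension of the group. The vector fields $U_k,V_k$ are the left-invariant horizontal vector fields of the hyperbolic Heisenberg group.
   Formalization: Where |ε²+|u|²−|v|²| < |t| the base B is negative and the literal equation can fail (n=4: φ=B², Lφ=+φ^{3/2}) or φ is not real (n odd); there φ is complex-valued and φ^{2*−1} means exp((2*−1)(n/2)Log B) = B^{n/2+1}. *)

theory Defs
  imports "HOL-Analysis.Analysis"
begin

text \<open>
  The hyperbolic Heisenberg group of topological dimension \<open>2n + 1\<close> is modelled on
  \<open>(real ^ 'n) \<times> (real ^ 'n) \<times> real\<close> with \<open>n = CARD('n)\<close>; a point is \<open>(u, v, t)\<close>.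
  Differential operators act on functions with values in any real normed space, since
  both real-valued and complex-valued functions are needed below.
\<close>

type_synonym 'n heis = "(real ^ 'n) \<times> (real ^ 'n) \<times> real"

definition dderiv :: "'a::real_normed_vector \<Rightarrow> ('a \<Rightarrow> 'b::real_normed_vector) \<Rightarrow> 'a \<Rightarrow> 'b" where
  "dderiv h f p = vector_derivative (\<lambda>s. f (p + s *\<^sub>R h)) (at 0)"

definition U :: "'n::finite \<Rightarrow> ('n heis \<Rightarrow> 'b::real_normed_vector) \<Rightarrow> 'n heis \<Rightarrow> 'b" where
  "U k f = (\<lambda>(u, v, t). dderiv (axis k 1, 0, 0) f (u, v, t)
                        - (2 * v $ k) *\<^sub>R dderiv (0, 0, 1) f (u, v, t))"

definition V :: "'n::finite \<Rightarrow> ('n heis \<Rightarrow> 'b::real_normed_vector) \<Rightarrow> 'n heis \<Rightarrow> 'b" where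
  "V k f = (\<lambda>(u, v, t). dderiv (0, axis k 1, 0) f (u, v, t)
                        + (2 * u $ k) *\<^sub>R dderiv (0, 0, 1) f (u, v, t))"

definition ultrahyp :: "('n::finite heis \<Rightarrow> 'b::real_normed_vector) \<Rightarrow> 'n heis \<Rightarrow> 'b" where
  "ultrahyp f p = (\<Sum>k\<in>UNIV. U k (U k f) p - V k (V k f) p)"

text \<open>\<open>C^k\<close> regularity; intended for open \<open>S\<close> in a finite-dimensional space.\<close>

primrec Ck_on :: "nat \<Rightarrow> 'a::euclidean_space set \<Rightarrow> ('a \<Rightarrow> 'b::real_normed_vector) \<Rightarrow> bool" where
  "Ck_on 0 S f \<longleftrightarrow> continuous_on S f"
| "Ck_on (Suc k) S f \<longleftrightarrow> (\<forall>p\<in>S. f differentiable (at p)) \<and> (\<forall>h. Ck_on k S (dderiv h f))"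

definition hom_dim :: "'n::finite itself \<Rightarrow> real" where
  "hom_dim _ = 2 * real CARD('n) + 2"

text \<open>The exponent \<open>2* - 1 = (Q + 2) / (Q - 2)\<close> for the homogeneous dimension \<open>Q\<close>.\<close>

definition yamabe_exponent :: "'n::finite itself \<Rightarrow> real" where
  "yamabe_exponent T = (hom_dim T + 2) / (hom_dim T - 2)"

text \<open>
  \<open>f\<close> is a classical solution on \<open>S\<close> of \<open>ultrahyp f = - f ^ (2* - 1)\<close>, where the
  function \<open>F\<close> is the power \<open>f ^ (2* - 1)\<close>. It is a parameter because for values of
  \<open>f\<close> that are not positive reals the power depends on a choice of \<open>log f\<close>.
\<close>

definition yamabe_solution_on ::
    "'n::finite heis set \<Rightarrow> ('n heis \<Rightarrow> 'b::real_normed_vector) \<Rightarrow> ('n heis \<Rightarrow> 'b) \<Rightarrow> bool" where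
  "yamabe_solution_on S f F \<longleftrightarrow> Ck_on 2 S f \<and> (\<forall>p\<in>S. ultrahyp f p = - F p)"

definition log_branch_on :: "'a::topological_space set \<Rightarrow> ('a \<Rightarrow> complex) \<Rightarrow> ('a \<Rightarrow> complex) \<Rightarrow> bool" where
  "log_branch_on S l f \<longleftrightarrow> continuous_on S l \<and> (\<forall>p\<in>S. exp (l p) = f p)"

definition regular_set :: "real \<Rightarrow> 'n::finite heis set" where
  "regular_set \<epsilon> = {(u, v, t). \<bar>\<epsilon>\<^sup>2 + (norm u)\<^sup>2 - (norm v)\<^sup>2\<bar> \<noteq> \<bar>t\<bar>}"

definition positive_set :: "real \<Rightarrow> 'n::finite heis set" where
  "positive_set \<epsilon> = {(u, v, t). \<bar>\<epsilon>\<^sup>2 + (norm u)\<^sup>2 - (norm v)\<^sup>2\<bar> > \<bar>t\<bar>}"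

definition phi_base :: "real \<Rightarrow> 'n::finite heis \<Rightarrow> real" where
  "phi_base \<epsilon> = (\<lambda>(u, v, t). 4 * (real CARD('n))\<^sup>2 * \<epsilon>\<^sup>2
                     / ((\<epsilon>\<^sup>2 + (norm u)\<^sup>2 - (norm v)\<^sup>2)\<^sup>2 - t\<^sup>2))"

text \<open>
  For \<open>\<epsilon> > 0\<close>, \<open>phi_base \<epsilon>\<close> is positive exactly on \<open>positive_set \<epsilon>\<close>, and \<open>phi\<close> is only
  meaningful there, because real \<open>powr\<close> is not the intended power for a negative base.
  On the rest of \<open>regular_set \<epsilon>\<close> the base is negative and its power \<open>n/2\<close> is in general
  complex; it is given by \<open>cphi\<close>, which is the ordinary integer power if \<open>n\<close> is even.
\<close>

definition phi :: "real \<Rightarrow> 'n::finite heis \<Rightarrow> real" where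
  "phi \<epsilon> p = phi_base \<epsilon> p powr (real CARD('n) / 2)"

definition cphi :: "real \<Rightarrow> 'n::finite heis \<Rightarrow> complex" where
  "cphi \<epsilon> p = complex_of_real (phi_base \<epsilon> p) powr complex_of_real (real CARD('n) / 2)"

text \<open>
  The logarithm of \<open>cphi\<close> induced by the logarithm of its base. It fixes the branch of
  the power: \<open>cphi ^ a = exp (a * cphi_log)\<close>, so that the law
  \<open>(B ^ (n/2)) ^ a = B ^ (n a / 2)\<close> holds. It may differ from \<open>Ln (cphi \<epsilon> p)\<close> when the
  base \<open>B\<close> is negative, and it is \<open>ln (phi \<epsilon> p)\<close> when \<open>B\<close> is positive.
\<close>

definition cphi_log :: "real \<Rightarrow> 'n::finite heis \<Rightarrow> complex" where
  "cphi_log \<epsilon> p = complex_of_real (real CARD('n) / 2) * Ln (complex_of_real (phi_base \<epsilon> p))"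

end

theory Submission
  imports Defs
begin

text \<open>
  Put \<open>A = \<epsilon>\<^sup>2 + |u|\<^sup>2 - |v|\<^sup>2\<close> and \<open>D = A\<^sup>2 - t\<^sup>2\<close>, so that the candidate solution is a constant
  multiple of \<open>D\<close> to the power \<open>s = - n / 2\<close>. The vector fields act on \<open>D\<close> by
  \<open>U\<^sub>k D = 4 (A u\<^sub>k + t v\<^sub>k)\<close> and \<open>V\<^sub>k D = - 4 (A v\<^sub>k + t u\<^sub>k)\<close>. Two cancellations follow. First,
  \<open>U\<^sub>k\<^sup>2 D - V\<^sub>k\<^sup>2 D = 8 A + 16 (u\<^sub>k\<^sup>2 - v\<^sub>k\<^sup>2)\<close>. Secondly, the mixed terms drop out of
  \<open>(U\<^sub>k D)\<^sup>2 - (V\<^sub>k D)\<^sup>2 = 16 D (u\<^sub>k\<^sup>2 - v\<^sub>k\<^sup>2)\<close>, so this again contains the factor \<open>D\<close>. Summing over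
  \<open>k\<close> and using \<open>|u|\<^sup>2 - |v|\<^sup>2 = A - \<epsilon>\<^sup>2\<close>, the operator multiplies \<open>D\<close> to the power \<open>s\<close> by
  \<open>8 s (n A + 2 s (A - \<epsilon>\<^sup>2)) / D\<close>, which is the content of \<open>ultrahyp_gauge_power\<close>. The choice
  \<open>s = - n / 2\<close> is exactly the one that removes \<open>A\<close>: the factor becomes
  \<open>- 4 n\<^sup>2 \<epsilon>\<^sup>2 / D\<close>, which is minus the base of the power. As \<open>2* - 1 = 1 + 2 / n\<close>, multiplying
  by the base is the same as raising the solution to the power \<open>2* - 1\<close>.

  The computation sees the function \<open>f\<close> only through its logarithmic derivative \<open>s dD / D\<close>, which is
  real. It is therefore carried out once, for values in an arbitrary normed space, and applies to
  the real power where \<open>D > 0\<close> and to the complex power where \<open>D \<noteq> 0\<close>. In the complex case no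
  branch cut interferes: the base is real and has no zeros, so where it is negative its principal
  logarithm has the constant imaginary part \<open>\<pi>\<close>
  (\<open>has_derivative_Ln_of_real\<close>).
\<close>

section \<open>Horizontal derivatives\<close>

lemma has_derivative_imp_dderiv:
  assumes "(f has_derivative f') (at p)"
  shows "dderiv h f p = f' h"
proof -
  have "((\<lambda>s::real. p + s *\<^sub>R h) has_derivative (\<lambda>s. s *\<^sub>R h)) (at 0)"
    by (auto intro!: derivative_eq_intros)
  then have "((\<lambda>s. f (p + s *\<^sub>R h)) has_derivative (\<lambda>s. f' (s *\<^sub>R h))) (at 0)"
    by (rule has_derivative_compose) (use assms in simp)
  then have "((\<lambda>s. f (p + s *\<^sub>R h)) has_vector_derivative f' h) (at 0)"
    using has_derivative_bounded_linear[OF assms]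
    by (simp add: has_vector_derivative_def linear_simps)
  then show ?thesis
    unfolding dderiv_def by (rule vector_derivative_at)
qed

text \<open>
  At a point of differentiability the two directional derivatives that make up \<open>U\<^sub>k\<close> combine to the
  derivative along one vector, so the chain and product rules for total derivatives apply to \<open>U\<^sub>k\<close>
  and, in the next lemma, to \<open>V\<^sub>k\<close>.
\<close>

lemma U_eq_derivative:
  fixes f :: "'n::finite heis \<Rightarrow> 'b::real_normed_vector"
  assumes "(f has_derivative f') (at p)"
  shows "U k f p = f' (axis k 1, 0, - 2 * fst (snd p) $ k)"
proof -
  interpret bounded_linear f' by (rule has_derivative_bounded_linear[OF assms])
  have "(axis k 1, 0, - 2 * fst (snd p) $ k) =
      (axis k 1, 0, 0) - (2 * fst (snd p) $ k) *\<^sub>R ((0, 0, 1) :: 'n heis)"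
    by simp
  then have "f' (axis k 1, 0, - 2 * fst (snd p) $ k) =
      f' (axis k 1, 0, 0) - (2 * fst (snd p) $ k) *\<^sub>R f' (0, 0, 1)"
    by (simp only: diff scaleR)
  then show ?thesis
    unfolding U_def by (simp add: has_derivative_imp_dderiv[OF assms] split_beta)
qed

lemma V_eq_derivative:
  fixes f :: "'n::finite heis \<Rightarrow> 'b::real_normed_vector"
  assumes "(f has_derivative f') (at p)"
  shows "V k f p = f' (0, axis k 1, 2 * fst p $ k)"
proof -
  interpret bounded_linear f' by (rule has_derivative_bounded_linear[OF assms])
  have "(0, axis k 1, 2 * fst p $ k) =
      (0, axis k 1, 0) + (2 * fst p $ k) *\<^sub>R ((0, 0, 1) :: 'n heis)"
    by simp
  then have "f' (0, axis k 1, 2 * fst p $ k) =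
      f' (0, axis k 1, 0) + (2 * fst p $ k) *\<^sub>R f' (0, 0, 1)"
    by (simp only: add scaleR)
  then show ?thesis
    unfolding V_def by (simp add: has_derivative_imp_dderiv[OF assms] split_beta)
qed

section \<open>Functions with a real logarithmic derivative\<close>

text \<open>
  If \<open>df = \<omega> f\<close> with a real one-form \<open>\<omega>\<close>, then every derivative of \<open>f\<close> is a real function times \<open>f\<close>.
  This product rule computes the derivative of such a multiple; iterating it gives all higher
  derivatives. The function \<open>g\<close> need only agree with \<open>m f\<close> on the open set, since directional
  derivatives of \<open>f\<close> are known only there.
\<close>

lemma has_derivative_scaleR_log_derivative:
  fixes f :: "'a::real_normed_vector \<Rightarrow> 'b::real_normed_vector"
  assumes f: "\<And>q. q \<in> S \<Longrightarrow> (f has_derivative (\<lambda>h. \<omega> q h *\<^sub>R f q)) (at q)"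
    and m: "(m has_derivative m') (at p)"
    and S: "open S" "p \<in> S"
    and g: "\<And>q. q \<in> S \<Longrightarrow> g q = m q *\<^sub>R f q"
  shows "(g has_derivative (\<lambda>h. (m' h + m p * \<omega> p h) *\<^sub>R f p)) (at p)"
proof -
  have "((\<lambda>q. m q *\<^sub>R f q) has_derivative (\<lambda>h. (m' h + m p * \<omega> p h) *\<^sub>R f p)) (at p)"
    by (rule has_derivative_eq_rhs[OF has_derivative_scaleR[OF m f]])
      (auto simp: S algebra_simps)
  then show ?thesis
    by (rule has_derivative_transform_within_open[OF _ S]) (simp add: g)
qed

lemma Ck_on_2_log_derivative:
  fixes f :: "'a::euclidean_space \<Rightarrow> 'b::real_normed_vector"
  assumes S: "open S"
    and f: "\<And>q. q \<in> S \<Longrightarrow> (f has_derivative (\<lambda>h. \<omega> q h *\<^sub>R f q)) (at q)"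
    and \<omega>: "\<And>q h. q \<in> S \<Longrightarrow> ((\<lambda>q. \<omega> q h) has_derivative \<omega>' q h) (at q)"
    and cont: "\<And>h h'. continuous_on S (\<lambda>q. \<omega>' q h h')"
  shows "Ck_on 2 S f"
proof -
  have 1: "dderiv h f q = \<omega> q h *\<^sub>R f q" if "q \<in> S" for h q
    using has_derivative_imp_dderiv[OF f[OF that]] .
  have 2: "(dderiv h f has_derivative (\<lambda>k. (\<omega>' q h k + \<omega> q h * \<omega> q k) *\<^sub>R f q)) (at q)"
    if "q \<in> S" for h q
    by (rule has_derivative_scaleR_log_derivative[OF f \<omega>[OF that] S that 1])
  have contf: "continuous_on S f"
    using f by (meson continuous_at_imp_continuous_on has_derivative_continuous)
  have cont\<omega>: "continuous_on S (\<lambda>q. \<omega> q h)" for h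
    using \<omega> by (meson continuous_at_imp_continuous_on has_derivative_continuous)
  have 3: "continuous_on S (dderiv k (dderiv h f))" for h k
  proof -
    have "continuous_on S (\<lambda>q. (\<omega>' q h k + \<omega> q h * \<omega> q k) *\<^sub>R f q)"
      by (intro continuous_intros cont cont\<omega> contf)
    then show ?thesis
      by (rule continuous_on_eq) (simp add: has_derivative_imp_dderiv[OF 2])
  qed
  show ?thesis
    unfolding numeral_2_eq_2 Ck_on.simps differentiable_def
    using f 2 3 by blast
qed

section \<open>The quadratic form under the power\<close>

text \<open>
  Inner products replace the squared norms because they are differentiable without a case
  distinction at the origin.
\<close>

definition gauge_A :: "real \<Rightarrow> 'n::finite heis \<Rightarrow> real" where
  "gauge_A \<epsilon> p = \<epsilon>\<^sup>2 + fst p \<bullet> fst p - fst (snd p) \<bullet> fst (snd p)"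

definition gauge_D :: "real \<Rightarrow> 'n::finite heis \<Rightarrow> real" where
  "gauge_D \<epsilon> p = (gauge_A \<epsilon> p)\<^sup>2 - (snd (snd p))\<^sup>2"

definition gauge_D' :: "real \<Rightarrow> 'n::finite heis \<Rightarrow> 'n heis \<Rightarrow> real" where
  "gauge_D' \<epsilon> p h = 4 * gauge_A \<epsilon> p * (fst p \<bullet> fst h - fst (snd p) \<bullet> fst (snd h))
     - 2 * snd (snd p) * snd (snd h)"

lemma has_derivative_gauge_A:
  "(gauge_A \<epsilon> has_derivative (\<lambda>h. 2 * (fst p \<bullet> fst h - fst (snd p) \<bullet> fst (snd h)))) (at p)"
  unfolding gauge_A_def
  by (auto intro!: derivative_eq_intros simp: inner_commute)

lemma has_derivative_gauge_D:
  "(gauge_D \<epsilon> has_derivative gauge_D' \<epsilon> p) (at p)"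
  unfolding gauge_D_def
  by (auto intro!: derivative_eq_intros has_derivative_gauge_A
      simp: gauge_D'_def fun_eq_iff algebra_simps)

lemma continuous_on_gauge_A: "continuous_on S (gauge_A \<epsilon>)"
  using has_derivative_gauge_A
  by (meson continuous_at_imp_continuous_on has_derivative_continuous)

lemma continuous_on_gauge_D: "continuous_on S (gauge_D \<epsilon>)"
  using has_derivative_gauge_D
  by (meson continuous_at_imp_continuous_on has_derivative_continuous)

lemma continuous_on_gauge_D': "continuous_on S (\<lambda>q. gauge_D' \<epsilon> q h)"
  unfolding gauge_D'_def by (intro continuous_intros continuous_on_gauge_A)

definition gauge_D'' :: "real \<Rightarrow> 'n::finite heis \<Rightarrow> 'n heis \<Rightarrow> 'n heis \<Rightarrow> real" where
  "gauge_D'' \<epsilon> p h k =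
     8 * (fst p \<bullet> fst k - fst (snd p) \<bullet> fst (snd k))
       * (fst p \<bullet> fst h - fst (snd p) \<bullet> fst (snd h))
     + 4 * gauge_A \<epsilon> p * (fst k \<bullet> fst h - fst (snd k) \<bullet> fst (snd h))
     - 2 * snd (snd k) * snd (snd h)"

lemma has_derivative_gauge_D':
  "((\<lambda>q. gauge_D' \<epsilon> q h) has_derivative gauge_D'' \<epsilon> p h) (at p)"
  unfolding gauge_D'_def
  by (auto intro!: derivative_eq_intros has_derivative_gauge_A
      simp: gauge_D''_def fun_eq_iff algebra_simps)

lemma continuous_on_gauge_D'': "continuous_on S (\<lambda>q. gauge_D'' \<epsilon> q h k)"
  unfolding gauge_D''_def by (intro continuous_intros continuous_on_gauge_A)

lemma has_derivative_divide_gauge_D: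
  assumes "(P has_derivative P') (at p)" "gauge_D \<epsilon> p \<noteq> 0"
  shows "((\<lambda>q. s * P q / gauge_D \<epsilon> q) has_derivative
    (\<lambda>h. s * (P' h / gauge_D \<epsilon> p - P p * gauge_D' \<epsilon> p h / (gauge_D \<epsilon> p)\<^sup>2))) (at p)"
  using assms
  by (auto intro!: derivative_eq_intros has_derivative_gauge_D
      simp: fun_eq_iff field_simps power2_eq_square)

lemma Ck_on_2_gauge_power:
  fixes f :: "'n::finite heis \<Rightarrow> 'b::real_normed_vector"
  assumes S: "open S" and D: "\<And>q. q \<in> S \<Longrightarrow> gauge_D \<epsilon> q \<noteq> 0"
    and f: "\<And>q. q \<in> S \<Longrightarrow>
      (f has_derivative (\<lambda>h. (s * gauge_D' \<epsilon> q h / gauge_D \<epsilon> q) *\<^sub>R f q)) (at q)"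
  shows "Ck_on 2 S f"
proof (rule Ck_on_2_log_derivative[OF S f])
  fix q h assume "q \<in> S"
  then show "((\<lambda>q. s * gauge_D' \<epsilon> q h / gauge_D \<epsilon> q) has_derivative
    (\<lambda>k. s * (gauge_D'' \<epsilon> q h k / gauge_D \<epsilon> q
      - gauge_D' \<epsilon> q h * gauge_D' \<epsilon> q k / (gauge_D \<epsilon> q)\<^sup>2))) (at q)"
    by (intro has_derivative_divide_gauge_D has_derivative_gauge_D' D)
next
  fix h k
  show "continuous_on S (\<lambda>q. s * (gauge_D'' \<epsilon> q h k / gauge_D \<epsilon> q
      - gauge_D' \<epsilon> q h * gauge_D' \<epsilon> q k / (gauge_D \<epsilon> q)\<^sup>2))"
    by (intro continuous_intros continuous_on_gauge_D'' continuous_on_gauge_D'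
        continuous_on_gauge_D) (simp_all add: D)
qed

definition U_gauge :: "real \<Rightarrow> 'n::finite \<Rightarrow> 'n heis \<Rightarrow> real" where
  "U_gauge \<epsilon> k p = 4 * (gauge_A \<epsilon> p * fst p $ k + snd (snd p) * fst (snd p) $ k)"

definition V_gauge :: "real \<Rightarrow> 'n::finite \<Rightarrow> 'n heis \<Rightarrow> real" where
  "V_gauge \<epsilon> k p = - 4 * (gauge_A \<epsilon> p * fst (snd p) $ k + snd (snd p) * fst p $ k)"

lemma gauge_D'_U: "gauge_D' \<epsilon> p (axis k 1, 0, - 2 * fst (snd p) $ k) = U_gauge \<epsilon> k p"
  by (simp add: gauge_D'_def U_gauge_def inner_axis algebra_simps)

lemma gauge_D'_V: "gauge_D' \<epsilon> p (0, axis k 1, 2 * fst p $ k) = V_gauge \<epsilon> k p"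
  by (simp add: gauge_D'_def V_gauge_def inner_axis algebra_simps)

lemma has_derivative_component: "((\<lambda>q. (f q :: real ^ 'n) $ k) has_derivative (\<lambda>h. f' h $ k)) F"
  if "(f has_derivative f') F"
  using bounded_linear.has_derivative[OF bounded_linear_vec_nth that] .

lemma has_derivative_U_gauge:
  "(U_gauge \<epsilon> k has_derivative (\<lambda>h. 4 * (gauge_A \<epsilon> p * fst h $ k
     + 2 * (fst p \<bullet> fst h - fst (snd p) \<bullet> fst (snd h)) * fst p $ k
     + snd (snd p) * fst (snd h) $ k + snd (snd h) * fst (snd p) $ k))) (at p)"
  unfolding U_gauge_def
  by (auto intro!: derivative_eq_intros has_derivative_gauge_A has_derivative_component
      simp: fun_eq_iff algebra_simps)

lemma has_derivative_V_gauge: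
  "(V_gauge \<epsilon> k has_derivative (\<lambda>h. - 4 * (gauge_A \<epsilon> p * fst (snd h) $ k
     + 2 * (fst p \<bullet> fst h - fst (snd p) \<bullet> fst (snd h)) * fst (snd p) $ k
     + snd (snd p) * fst h $ k + snd (snd h) * fst p $ k))) (at p)"
  unfolding V_gauge_def
  by (auto intro!: derivative_eq_intros has_derivative_gauge_A has_derivative_component
      simp: fun_eq_iff algebra_simps)

text \<open>
  The operator acts on a power of \<open>D\<close> as multiplication by a function, for every exponent \<open>s\<close>. The
  terms of order \<open>1 / D\<^sup>2\<close> in \<open>U\<^sub>k\<^sup>2 f\<close> and \<open>V\<^sub>k\<^sup>2 f\<close> do not cancel individually, but their difference
  is divisible by \<open>D\<close>.
\<close>

lemma ultrahyp_gauge_power: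
  fixes f :: "'n::finite heis \<Rightarrow> 'b::real_normed_vector"
  assumes S: "open S" "p \<in> S" and D: "\<And>q. q \<in> S \<Longrightarrow> gauge_D \<epsilon> q \<noteq> 0"
    and f: "\<And>q. q \<in> S \<Longrightarrow>
      (f has_derivative (\<lambda>h. (s * gauge_D' \<epsilon> q h / gauge_D \<epsilon> q) *\<^sub>R f q)) (at q)"
  shows "ultrahyp f p =
    (8 * s * (real CARD('n) * gauge_A \<epsilon> p + 2 * s * (gauge_A \<epsilon> p - \<epsilon>\<^sup>2)) / gauge_D \<epsilon> p) *\<^sub>R f p"
proof -
  let ?A = "gauge_A \<epsilon> p" and ?D = "gauge_D \<epsilon> p"
  let ?u = "fst p" and ?v = "fst (snd p)" and ?t = "snd (snd p)"
  have Dp: "?D \<noteq> 0" using D S by blast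
  have Uf: "U k f q = (s * U_gauge \<epsilon> k q / gauge_D \<epsilon> q) *\<^sub>R f q" if "q \<in> S" for k q
    using U_eq_derivative[OF f[OF that]] by (simp only: gauge_D'_U)
  have Vf: "V k f q = (s * V_gauge \<epsilon> k q / gauge_D \<epsilon> q) *\<^sub>R f q" if "q \<in> S" for k q
    using V_eq_derivative[OF f[OF that]] by (simp only: gauge_D'_V)
  have UU: "U k (U k f) p = (s * (4 * ?A + 8 * ((?u $ k)\<^sup>2 - (?v $ k)\<^sup>2)) / ?D
      + s * (s - 1) * (U_gauge \<epsilon> k p)\<^sup>2 / ?D\<^sup>2) *\<^sub>R f p" for k
    by (rule trans[OF U_eq_derivative[OF has_derivative_scaleR_log_derivative
            [OF f has_derivative_divide_gauge_D[OF has_derivative_U_gauge Dp] S Uf]]],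
        assumption+, unfold gauge_D'_U, rule arg_cong[where f = "\<lambda>c. c *\<^sub>R f p"])
      (use Dp in \<open>simp add: inner_axis field_simps power2_eq_square\<close>)
  have VV: "V k (V k f) p = (s * (- 4 * ?A - 8 * ((?u $ k)\<^sup>2 - (?v $ k)\<^sup>2)) / ?D
      + s * (s - 1) * (V_gauge \<epsilon> k p)\<^sup>2 / ?D\<^sup>2) *\<^sub>R f p" for k
    by (rule trans[OF V_eq_derivative[OF has_derivative_scaleR_log_derivative
            [OF f has_derivative_divide_gauge_D[OF has_derivative_V_gauge Dp] S Vf]]],
        assumption+, unfold gauge_D'_V, rule arg_cong[where f = "\<lambda>c. c *\<^sub>R f p"])
      (use Dp in \<open>simp add: inner_axis field_simps power2_eq_square\<close>)
  \<comment> \<open>the factorisation \<open>(A u + t v)\<^sup>2 - (A v + t u)\<^sup>2 = (A\<^sup>2 - t\<^sup>2) (u\<^sup>2 - v\<^sup>2)\<close>\<close>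
  have sq: "(U_gauge \<epsilon> k p)\<^sup>2 - (V_gauge \<epsilon> k p)\<^sup>2 = 16 * ?D * ((?u $ k)\<^sup>2 - (?v $ k)\<^sup>2)" for k
    by (simp add: U_gauge_def V_gauge_def gauge_D_def power2_eq_square algebra_simps)
  have "U k (U k f) p - V k (V k f) p =
      (8 * s * (?A + 2 * s * ((?u $ k)\<^sup>2 - (?v $ k)\<^sup>2)) / ?D) *\<^sub>R f p" for k
  proof -
    have "U k (U k f) p - V k (V k f) p = (s * (8 * ?A + 16 * ((?u $ k)\<^sup>2 - (?v $ k)\<^sup>2)) / ?D
      + s * (s - 1) * ((U_gauge \<epsilon> k p)\<^sup>2 - (V_gauge \<epsilon> k p)\<^sup>2) / ?D\<^sup>2) *\<^sub>R f p"
      unfolding UU VV scaleR_diff_left[symmetric]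
      by (simp add: algebra_simps add_divide_distrib diff_divide_distrib)
    also have "\<dots> = (8 * s * (?A + 2 * s * ((?u $ k)\<^sup>2 - (?v $ k)\<^sup>2)) / ?D) *\<^sub>R f p"
      unfolding sq using Dp by (simp add: field_simps power2_eq_square)
    finally show ?thesis .
  qed
  then have "ultrahyp f p =
      (\<Sum>k\<in>UNIV. 8 * s * (?A + 2 * s * ((?u $ k)\<^sup>2 - (?v $ k)\<^sup>2)) / ?D) *\<^sub>R f p"
    unfolding ultrahyp_def by (simp add: scaleR_sum_left)
  also have "(\<Sum>k\<in>UNIV. 8 * s * (?A + 2 * s * ((?u $ k)\<^sup>2 - (?v $ k)\<^sup>2)) / ?D) =
      8 * s * (real CARD('n) * ?A + 2 * s * (\<Sum>k\<in>UNIV. (?u $ k)\<^sup>2 - (?v $ k)\<^sup>2)) / ?D"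
    by (simp add: sum.distrib flip: sum_distrib_left sum_divide_distrib)
  also have "(\<Sum>k\<in>UNIV. (?u $ k)\<^sup>2 - (?v $ k)\<^sup>2) = ?A - \<epsilon>\<^sup>2"
    by (simp add: gauge_A_def inner_vec_def power2_eq_square sum_subtractf)
  finally show ?thesis .
qed

section \<open>Both branches of the power\<close>

lemma phi_base_eq_gauge: "phi_base \<epsilon> p = 4 * (real CARD('n))\<^sup>2 * \<epsilon>\<^sup>2 / gauge_D \<epsilon> p"
  for p :: "'n::finite heis"
  by (simp add: phi_base_def gauge_D_def gauge_A_def split_beta power2_norm_eq_inner)

lemma regular_set_eq_gauge: "regular_set \<epsilon> = {p. gauge_D \<epsilon> p \<noteq> 0}"
  by (auto simp: regular_set_def gauge_D_def gauge_A_def power2_norm_eq_inner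
      power2_eq_iff abs_eq_iff)

lemma positive_set_eq_gauge: "positive_set \<epsilon> = {p. gauge_D \<epsilon> p > 0}"
  by (auto simp: positive_set_def gauge_D_def gauge_A_def power2_norm_eq_inner
      abs_le_square_iff not_le[symmetric])

text \<open>
  Here \<open>l\<close> is any logarithm of \<open>f\<close> with derivative \<open>- (n / 2) dD / D\<close>. Adding a locally constant
  function to \<open>l\<close> preserves this hypothesis, which is why real and complex powers are covered alike,
  and the nonlinearity is taken in the form \<open>phi_base * f\<close>, in which no power of \<open>f\<close> has to be
  chosen.
\<close>

lemma yamabe_solution_exp_log_gauge:
  fixes l :: "'n::finite heis \<Rightarrow> 'b::{banach, real_normed_field}"
  assumes S: "open S" and D: "\<And>q. q \<in> S \<Longrightarrow> gauge_D \<epsilon> q \<noteq> 0"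
    and l: "\<And>q. q \<in> S \<Longrightarrow> (l has_derivative
      (\<lambda>h. of_real (- (real CARD('n) / 2) * gauge_D' \<epsilon> q h / gauge_D \<epsilon> q))) (at q)"
    and f: "\<And>q. q \<in> S \<Longrightarrow> f q = exp (l q)"
    and F: "\<And>q. q \<in> S \<Longrightarrow> F q = of_real (phi_base \<epsilon> q) * f q"
  shows "yamabe_solution_on S f F"
proof -
  let ?s = "- (real CARD('n) / 2)"
  have df: "(f has_derivative (\<lambda>h. (?s * gauge_D' \<epsilon> q h / gauge_D \<epsilon> q) *\<^sub>R f q)) (at q)"
    if q: "q \<in> S" for q
  proof -
    have "((\<lambda>q. exp (l q)) has_derivative
        (\<lambda>h. exp (l q) * of_real (?s * gauge_D' \<epsilon> q h / gauge_D \<epsilon> q))) (at q)"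
      using has_derivative_compose[OF l[OF q] DERIV_exp[unfolded has_field_derivative_def]] .
    then have "(f has_derivative
        (\<lambda>h. exp (l q) * of_real (?s * gauge_D' \<epsilon> q h / gauge_D \<epsilon> q))) (at q)"
      by (rule has_derivative_transform_within_open[OF _ S q]) (simp add: f)
    then show ?thesis
      by (simp add: f[OF q] scaleR_conv_of_real mult.commute)
  qed
  have "ultrahyp f q = - F q" if "q \<in> S" for q
  proof -
    \<comment> \<open>the exponent \<open>- n / 2\<close> makes the two multiples of \<open>A\<close> cancel\<close>
    have "8 * ?s * (real CARD('n) * gauge_A \<epsilon> q + 2 * ?s * (gauge_A \<epsilon> q - \<epsilon>\<^sup>2)) / gauge_D \<epsilon> q
        = - phi_base \<epsilon> q"
      by (simp add: phi_base_eq_gauge power2_eq_square algebra_simps)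
    then show ?thesis
      using ultrahyp_gauge_power[OF S that D df]
      by (simp only: F[OF that] scaleR_conv_of_real of_real_minus mult_minus_left)
  qed
  moreover have "Ck_on 2 S f"
    using Ck_on_2_gauge_power[OF S D df] .
  ultimately show ?thesis
    unfolding yamabe_solution_on_def by blast
qed

text \<open>
  The principal logarithm jumps across the negative real axis but not along it: on negative reals
  it is \<open>ln (- x) + \<i> \<pi>\<close>.
\<close>

lemma has_derivative_Ln_of_real:
  fixes x :: real
  assumes "x \<noteq> 0"
  shows "((\<lambda>x. Ln (complex_of_real x)) has_derivative (\<lambda>h. of_real (h / x))) (at x)"
proof (cases "x > 0")
  case True
  have "((\<lambda>x. complex_of_real (ln x)) has_derivative (\<lambda>h. of_real (h / x))) (at x)"
    using True by (auto intro!: derivative_eq_intros simp: divide_inverse)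
  then show ?thesis
    by (rule has_derivative_transform_within_open[where s = "{0<..}"])
      (use True in \<open>auto simp: Ln_of_real\<close>)
next
  case False
  then have x: "x < 0" using assms by simp
  have "((\<lambda>x. complex_of_real (ln (- x)) + \<i> * pi) has_derivative (\<lambda>h. of_real (h / x))) (at x)"
    using x by (auto intro!: derivative_eq_intros simp: divide_inverse)
  then show ?thesis
  proof (rule has_derivative_transform_within_open[where s = "{..<0}"])
    fix y :: real assume "y \<in> {..<0}"
    then show "complex_of_real (ln (- y)) + \<i> * pi = Ln (complex_of_real y)"
      using Ln_minus[of "complex_of_real (- y)"] Ln_of_real[of "- y"] by (auto simp: mult.commute)
  qed (use x in auto)
qed

lemma has_derivative_phi_base:
  assumes "gauge_D \<epsilon> p \<noteq> 0"
  shows "(phi_base \<epsilon> has_derivative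
    (\<lambda>h. - phi_base \<epsilon> p * gauge_D' \<epsilon> p h / gauge_D \<epsilon> p)) (at p)"
  unfolding phi_base_eq_gauge[abs_def] using assms
  by (auto intro!: derivative_eq_intros has_derivative_gauge_D
      simp: fun_eq_iff field_simps power2_eq_square)

theorem proposition8p1:
  fixes \<epsilon> :: real
  assumes "\<epsilon> > 0"
  shows "yamabe_exponent TYPE('n::finite) = (real CARD('n) + 2) / real CARD('n) \<and>
    yamabe_solution_on (positive_set \<epsilon> :: 'n heis set) (phi \<epsilon>)
      (\<lambda>p. phi \<epsilon> p powr yamabe_exponent TYPE('n)) \<and>
    (\<forall>p \<in> (positive_set \<epsilon> :: 'n heis set).
      cphi \<epsilon> p = complex_of_real (phi \<epsilon> p) \<and>
      cphi_log \<epsilon> p = complex_of_real (ln (phi \<epsilon> p))) \<and>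
    log_branch_on (regular_set \<epsilon> :: 'n heis set) (cphi_log \<epsilon>) (cphi \<epsilon>) \<and>
    yamabe_solution_on (regular_set \<epsilon> :: 'n heis set) (cphi \<epsilon>)
      (\<lambda>p. exp (complex_of_real (yamabe_exponent TYPE('n)) * cphi_log \<epsilon> p))"
proof -
  let ?n = "real CARD('n)"
  let ?P = "positive_set \<epsilon> :: 'n heis set" and ?R = "regular_set \<epsilon> :: 'n heis set"
  have n: "?n > 0" by simp
  have expo: "yamabe_exponent TYPE('n) = (?n + 2) / ?n"
    using n by (simp add: yamabe_exponent_def hom_dim_def field_simps)
  \<comment> \<open>raising a power \<open>n / 2\<close> of the base to \<open>2* - 1\<close> multiplies it by the base\<close>
  then have expo_half: "yamabe_exponent TYPE('n) * (?n / 2) = 1 + ?n / 2"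
    using n by (simp add: field_simps)
  have openP: "open ?P" and openR: "open ?R"
    unfolding positive_set_eq_gauge regular_set_eq_gauge
    by (intro open_Collect_less open_Collect_neq continuous_on_gauge_D continuous_on_const)+
  have P: "gauge_D \<epsilon> p > 0" "phi_base \<epsilon> p > 0" if "p \<in> ?P" for p
    using that assms by (auto simp: positive_set_eq_gauge phi_base_eq_gauge)
  have R: "gauge_D \<epsilon> p \<noteq> 0" "phi_base \<epsilon> p \<noteq> 0" if "p \<in> ?R" for p
    using that assms by (auto simp: regular_set_eq_gauge phi_base_eq_gauge)
  have exp_cphi_log: "exp (cphi_log \<epsilon> p) = cphi \<epsilon> p" if "p \<in> ?R" for p
    using R[OF that] by (simp add: cphi_def cphi_log_def powr_def)
  have d_cphi_log: "(cphi_log \<epsilon> has_derivative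
      (\<lambda>h. of_real (- (?n / 2) * gauge_D' \<epsilon> p h / gauge_D \<epsilon> p))) (at p)" if "p \<in> ?R" for p
  proof -
    have "((\<lambda>q. Ln (complex_of_real (phi_base \<epsilon> q))) has_derivative
        (\<lambda>h. of_real (- phi_base \<epsilon> p * gauge_D' \<epsilon> p h / gauge_D \<epsilon> p / phi_base \<epsilon> p))) (at p)"
      by (rule has_derivative_compose
          [OF has_derivative_phi_base has_derivative_Ln_of_real]) (use R[OF that] in auto)
    then have "((\<lambda>q. complex_of_real (?n / 2) * Ln (complex_of_real (phi_base \<epsilon> q))) has_derivative
        (\<lambda>h. complex_of_real (?n / 2) *
          of_real (- phi_base \<epsilon> p * gauge_D' \<epsilon> p h / gauge_D \<epsilon> p / phi_base \<epsilon> p))) (at p)"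
      by (rule has_derivative_mult_right)
    then show ?thesis
      unfolding cphi_log_def[abs_def] using R[OF that] by simp
  qed
  have d_log_phi: "((\<lambda>q. ?n / 2 * ln (phi_base \<epsilon> q)) has_derivative
      (\<lambda>h. of_real (- (?n / 2) * gauge_D' \<epsilon> p h / gauge_D \<epsilon> p))) (at p)" if "p \<in> ?P" for p
    using P[OF that]
    by (auto intro!: derivative_eq_intros has_derivative_phi_base simp: fun_eq_iff)
  have phi_pos: "phi \<epsilon> p > 0" if "p \<in> ?P" for p
    using P[OF that] by (simp add: phi_def)
  have real_sol: "yamabe_solution_on ?P (phi \<epsilon>) (\<lambda>p. phi \<epsilon> p powr yamabe_exponent TYPE('n))"
  proof (rule yamabe_solution_exp_log_gauge[OF openP _ d_log_phi])
    fix p assume p: "p \<in> ?P"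
    show "phi \<epsilon> p = exp (?n / 2 * ln (phi_base \<epsilon> p))"
      using P[OF p] by (simp add: phi_def powr_def)
    have "phi \<epsilon> p powr yamabe_exponent TYPE('n) = phi_base \<epsilon> p powr (1 + ?n / 2)"
      unfolding phi_def powr_powr by (simp only: expo_half[symmetric] mult.commute)
    also have "\<dots> = of_real (phi_base \<epsilon> p) * phi \<epsilon> p"
      using P[OF p] by (simp only: phi_def powr_add) simp
    finally show "phi \<epsilon> p powr yamabe_exponent TYPE('n) = of_real (phi_base \<epsilon> p) * phi \<epsilon> p" .
  qed (use P in force)
  have cphi_P: "cphi \<epsilon> p = complex_of_real (phi \<epsilon> p) \<and>
      cphi_log \<epsilon> p = complex_of_real (ln (phi \<epsilon> p))" if "p \<in> ?P" for p
    using P[OF that] powr_of_real[of "phi_base \<epsilon> p" "?n / 2"]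
    by (simp add: cphi_def cphi_log_def phi_def Ln_of_real ln_powr)
  have branch: "log_branch_on ?R (cphi_log \<epsilon>) (cphi \<epsilon>)"
    unfolding log_branch_on_def using exp_cphi_log d_cphi_log
    by (meson continuous_at_imp_continuous_on has_derivative_continuous)
  have complex_sol: "yamabe_solution_on ?R (cphi \<epsilon>)
      (\<lambda>p. exp (complex_of_real (yamabe_exponent TYPE('n)) * cphi_log \<epsilon> p))"
  proof (rule yamabe_solution_exp_log_gauge[OF openR _ d_cphi_log])
    fix p assume p: "p \<in> ?R"
    show "cphi \<epsilon> p = exp (cphi_log \<epsilon> p)" using exp_cphi_log[OF p] by simp
    have "complex_of_real (yamabe_exponent TYPE('n)) * cphi_log \<epsilon> p =
        complex_of_real (yamabe_exponent TYPE('n) * (?n / 2)) * Ln (complex_of_real (phi_base \<epsilon> p))"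
      by (simp add: cphi_log_def)
    also have "\<dots> = Ln (complex_of_real (phi_base \<epsilon> p)) + cphi_log \<epsilon> p"
      unfolding expo_half by (simp add: cphi_log_def algebra_simps)
    finally show "exp (complex_of_real (yamabe_exponent TYPE('n)) * cphi_log \<epsilon> p) =
        of_real (phi_base \<epsilon> p) * cphi \<epsilon> p"
      using R[OF p] exp_cphi_log[OF p] by (simp add: exp_add)
  qed (use R in auto)
  show ?thesis
    using expo real_sol cphi_P branch complex_sol by blast
qed

end
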